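(* Let $\Omega\subseteq\mathbb{C}$ be a connected open set. Let $T,\tilde T\in\mathcal{F}B_2(\Omega)$ be two operators of the form $\begin{pmatrix} T_0 & S \\ 0 & T_1 \end{pmatrix}$ and $\begin{pmatrix} \tilde T_0 & \tilde S \\ 0 & \tilde T_1 \end{pmatrix}$ with respect to the decompositions $\mathcal{H}=\mathcal{H}_0\oplus\mathcal{H}_1$ and $\tilde{\mathcal{H}}=\tilde{\mathcal{H}}_0\oplus\tilde{\mathcal{H}}_1$, respectively. Let $U=\begin{pmatrix} U_{11} & U_{12} \\ U_{21} & U_{22} \end{pmatrix}:\mathcal{H}_0\oplus\mathcal{H}_1\to\tilde{\mathcal{H}}_0\oplus\tilde{\mathcal{H}}_1$ be a unitary operator such that $$\begin{pmatrix} U_{11} & U_{12} \\ U_{21} & U_{22} \end{pmatrix}\begin{pmatrix} T_0 & S \\ 0 & T_1 \end{pmatrix}=\begin{pmatrix} \tilde T_0 & \tilde S \\ 0 & \tilde T_1 \end{pmatrix}\begin{pmatrix} U_{11} & U_{12} \\ U_{21} & U_{22} \end{pmatrix}.$$ Then $U_{12}=0$ and $U_{21}=0$.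
   Context: All Hilbert spaces are complex and separable and all operators are bounded and linear. For a connected open set $\Omega\subseteq\mathbb{C}$, $B_1(\Omega)$ (the Cowen-Douglas class of rank one) is the set of bounded operators $T$ on a Hilbert space $\mathcal{H}$ such that $\Omega\subset\sigma(T)$; $\mathrm{ran}(T-w)=\mathcal{H}$ for all $w\in\Omega$; the closed linear span of $\bigcup_{w\in\Omega}\ker(T-w)$ is $\mathcal{H}$; and $\dim\ker(T-w)=1$ for all $w\in\Omega$. $\mathcal{F}B_2(\Omega)$ is the set of bounded operators $T=\begin{pmatrix} T_0 & S \\ 0 & T_1 \end{pmatrix}$ on an orthogonal direct sum $\mathcal{H}_0\oplus\mathcal{H}_1$, where $T_0:\mathcal{H}_0\to\mathcal{H}_0$ and $T_1:\mathcal{H}_1\to\mathcal{H}_1$ are in $B_1(\Omega)$ and $S:\mathcal{H}_1\to\mathcal{H}_0$ is a non-zero bounded operator with $T_0S=ST_1$. *)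

theory Defs
  imports "HOL-Analysis.Analysis"
begin

section \<open>Complex separable Hilbert spaces\<close>

class scaleC =
  fixes scaleC :: "complex \<Rightarrow> 'a \<Rightarrow> 'a"  (infixr "*\<^sub>C" 75)

class complex_vector = scaleC + real_vector +
  assumes scaleC_add_right: "a *\<^sub>C (x + y) = a *\<^sub>C x + a *\<^sub>C y"
    and scaleC_add_left: "(a + b) *\<^sub>C x = a *\<^sub>C x + b *\<^sub>C x"
    and scaleC_scaleC: "a *\<^sub>C (b *\<^sub>C x) = (a * b) *\<^sub>C x"
    and scaleC_one: "1 *\<^sub>C x = x"
    and scaleR_scaleC: "r *\<^sub>R x = complex_of_real r *\<^sub>C x"

global_interpretation complex_vector: vector_space "scaleC :: complex \<Rightarrow> 'a \<Rightarrow> 'a::complex_vector"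
  by standard (simp_all add: scaleC_add_right scaleC_add_left scaleC_scaleC scaleC_one)

text \<open>
  The complex inner product is linear in the first argument.  It is tied to the library's real inner
  product, hence to its norm and topology, by \<open>inner x y = Re (cinner x y)\<close>; positive definiteness
  and \<open>norm x = sqrt (Re (cinner x x))\<close> are then inherited from \<^class>\<open>real_inner\<close>.
\<close>

class complex_inner = complex_vector + real_inner +
  fixes cinner :: "'a \<Rightarrow> 'a \<Rightarrow> complex"
  assumes cinner_commute: "cinner x y = cnj (cinner y x)"
    and cinner_add_left: "cinner (x + y) z = cinner x z + cinner y z"
    and cinner_scaleC_left: "cinner (a *\<^sub>C x) y = a * cinner x y"
    and inner_cinner: "inner x y = Re (cinner x y)"

text \<open>For metric spaces, second countability is the same as separability.\<close>

class complex_hilbert = complex_inner + complete_space + second_countable_topology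

text \<open>The orthogonal direct sum of two Hilbert spaces is the product type.\<close>

instantiation prod :: (complex_vector, complex_vector) complex_vector
begin

definition scaleC_prod :: "complex \<Rightarrow> 'a \<times> 'b \<Rightarrow> 'a \<times> 'b"
  where "scaleC_prod a p = (a *\<^sub>C fst p, a *\<^sub>C snd p)"

instance
  by standard
    (simp_all add: scaleC_prod_def scaleR_prod_def prod_eq_iff scaleC_add_right scaleC_add_left
      scaleC_scaleC scaleC_one scaleR_scaleC)

end

instantiation prod :: (complex_inner, complex_inner) complex_inner
begin

definition cinner_prod :: "'a \<times> 'b \<Rightarrow> 'a \<times> 'b \<Rightarrow> complex"
  where "cinner_prod p q = cinner (fst p) (fst q) + cinner (snd p) (snd q)"

instance
proof
  fix x y z :: "'a \<times> 'b" and a :: complex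
  show "cinner x y = cnj (cinner y x)"
    by (simp add: cinner_prod_def cinner_commute[symmetric])
  show "cinner (x + y) z = cinner x z + cinner y z"
    by (simp add: cinner_prod_def cinner_add_left)
  show "cinner (a *\<^sub>C x) y = a * cinner x y"
    by (simp add: cinner_prod_def scaleC_prod_def cinner_scaleC_left distrib_left)
  show "inner x y = Re (cinner x y)"
    by (simp add: cinner_prod_def inner_prod_def inner_cinner)
qed

end

instance prod :: (complex_hilbert, complex_hilbert) complex_hilbert ..


section \<open>Operators\<close>

definition bounded_clinear :: "('a::complex_inner \<Rightarrow> 'b::complex_inner) \<Rightarrow> bool"
  where "bounded_clinear f \<longleftrightarrow> bounded_linear f \<and> (\<forall>a x. f (a *\<^sub>C x) = a *\<^sub>C f x)"

definition unitary :: "('a::complex_inner \<Rightarrow> 'b::complex_inner) \<Rightarrow> bool"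
  where "unitary U \<longleftrightarrow>
    bounded_clinear U \<and> surj U \<and> (\<forall>x y. cinner (U x) (U y) = cinner x y)"

definition shifted :: "('a::complex_vector \<Rightarrow> 'a) \<Rightarrow> complex \<Rightarrow> 'a \<Rightarrow> 'a"
  where "shifted T w = (\<lambda>x. T x - w *\<^sub>C x)"

definition kernel :: "('a \<Rightarrow> 'b::zero) \<Rightarrow> 'a set"
  where "kernel T = {x. T x = 0}"

definition spectrum :: "('a::complex_inner \<Rightarrow> 'a) \<Rightarrow> complex set"
  where "spectrum T =
    {w. \<not> (\<exists>R. bounded_clinear R \<and> R \<circ> shifted T w = id \<and> shifted T w \<circ> R = id)}"

text \<open>\<open>block_op A B C D\<close> is the operator matrix with first row \<open>A, B\<close> and second row \<open>C, D\<close>.\<close>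

definition block_op ::
  "('a \<Rightarrow> 'c) \<Rightarrow> ('b \<Rightarrow> 'c) \<Rightarrow> ('a \<Rightarrow> 'd) \<Rightarrow> ('b \<Rightarrow> 'd) \<Rightarrow> 'a \<times> 'b \<Rightarrow> 'c::plus \<times> 'd::plus"
  where "block_op A B C D = (\<lambda>(x, y). (A x + B y, C x + D y))"


section \<open>Cowen-Douglas operators and the class FB2\<close>

text \<open>
  \<open>complex_vector.dim\<close> is \<open>0\<close> on infinite-dimensional subspaces, so the condition \<open>dim = 1\<close> does mean
  one-dimensional.
\<close>

definition B1 :: "complex set \<Rightarrow> ('a::complex_hilbert \<Rightarrow> 'a) set"
  where "B1 \<Omega> = {T. bounded_clinear T
    \<and> \<Omega> \<subseteq> spectrum T
    \<and> (\<forall>w\<in>\<Omega>. range (shifted T w) = UNIV)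
    \<and> closure (complex_vector.span (\<Union>w\<in>\<Omega>. kernel (shifted T w))) = UNIV
    \<and> (\<forall>w\<in>\<Omega>. complex_vector.dim (kernel (shifted T w)) = 1)}"

definition FB2 ::
  "complex set \<Rightarrow> ('a::complex_hilbert \<times> 'b::complex_hilbert \<Rightarrow> 'a \<times> 'b) set"
  where "FB2 \<Omega> = {block_op T0 S (\<lambda>_. 0) T1 | T0 S T1.
    T0 \<in> B1 \<Omega> \<and> T1 \<in> B1 \<Omega> \<and> bounded_clinear S \<and> S \<noteq> (\<lambda>_. 0) \<and> T0 \<circ> S = S \<circ> T1}"

end

theory Submission
  imports Defs "HOL-Complex_Analysis.Complex_Analysis"
begin

text \<open>Let \<open>V\<close> be the inverse of \<open>U\<close> and let \<open>P\<close>, \<open>Q\<close> be the lower left corners of \<open>U\<close>, \<open>V\<close>. They intertwine: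
  \<open>P T\<^sub>0 = T\<^sub>1' P\<close> and \<open>Q T\<^sub>0' = T\<^sub>1 Q\<close>, and the upper left corner \<open>R\<close> of \<open>U\<close> satisfies
  \<open>S' P = R T\<^sub>0 - T\<^sub>0' R\<close>. Hence \<open>N = Q S' P S\<close> commutes with \<open>T\<^sub>1\<close> and equals the commutator of
  \<open>Q R S\<close> with \<open>T\<^sub>1\<close>, so it is quasinilpotent by the Kleinecke-Shirokov argument; as it acts by
  scalars on the one-dimensional eigenspaces of \<open>T\<^sub>1\<close>, it vanishes. A nonzero intertwiner
  between operators in \<open>B1 \<Omega>\<close> has dense range, by analytic continuation along
  holomorphic families of eigenvectors; so \<open>N = 0\<close> forces \<open>P = 0\<close> or \<open>Q = 0\<close>. If one of them is zero,
  a diagonal corner is an isometric intertwiner with dense range, hence onto, and this makes the other one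
  zero too. Unitarity turns \<open>Q = 0\<close> into \<open>U\<^sub>1\<^sub>2 = 0\<close>.\<close>

instance complex_hilbert \<subseteq> banach ..

section \<open>Open mapping theorem and orthogonal complements\<close>

text \<open>The closed sets \<open>C n\<close> cover a Banach space, so by Baire one of them
  contains a ball. Symmetrizing moves this ball to the origin, and scaling gives the bound for every
  \<open>y\<close>.\<close>

lemma surj_bounded_linear_approx:
  fixes T :: "'a::real_normed_vector \<Rightarrow> 'b::banach"
  assumes "bounded_linear T" and "surj T"
  obtains K where "\<And>y e. e > 0 \<Longrightarrow> \<exists>x. norm x \<le> K * norm y \<and> norm (y - T x) < e"
proof -
  interpret T: bounded_linear T by fact
  define C where "C n = closure (T ` cball 0 (real n))" for n
  have "(\<Union>n. C n) = UNIV"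
  proof -
    have "y \<in> (\<Union>n. C n)" for y
    proof -
      obtain x where "T x = y"
        using \<open>surj T\<close> by (metis surjD)
      moreover obtain n where "norm x \<le> real n"
        using real_arch_simple by blast
      ultimately have "y \<in> C n"
        unfolding C_def by (intro closure_subset[THEN subsetD]) auto
      then show ?thesis by blast
    qed
    then show ?thesis by blast
  qed
  moreover have "completely_metrizable_space (euclidean :: 'b topology)"
    by (rule completely_metrizable_space_euclidean)
  ultimately obtain n where "interior (C n) \<noteq> {}"
    using Baire_category_alt[of "euclidean :: 'b topology" "range C"] by (auto simp: C_def)
  then obtain y0 e where e: "e > 0" "ball y0 e \<subseteq> C n"
    by (meson all_not_in_conv mem_interior)
  \<comment> \<open>Half the difference of approximate preimages of \<open>y0 + z\<close> and
    \<open>y0 - z\<close> is an approximate preimage of \<open>z\<close> and stays in the same norm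
    ball.\<close>
  have small: "\<exists>x. norm x \<le> n \<and> norm (z - T x) < d" if z: "norm z < e" and "d > 0" for z d
  proof -
    have "y0 + z \<in> C n" "y0 - z \<in> C n"
      using z e by (auto simp: dist_norm)
    then obtain a b where a: "norm a \<le> n" "norm (y0 + z - T a) < d"
      and b: "norm b \<le> n" "norm (y0 - z - T b) < d"
      using \<open>d > 0\<close> by (force simp: C_def closure_approachable dist_norm norm_minus_commute)
    have "2 *\<^sub>R (z - T ((1/2) *\<^sub>R (a - b))) = (y0 + z - T a) - (y0 - z - T b)"
      by (simp add: T.scaleR T.diff algebra_simps scaleR_2)
    then have "2 * norm (z - T ((1/2) *\<^sub>R (a - b))) \<le> norm (y0 + z - T a) + norm (y0 - z - T b)"
      by (metis abs_numeral norm_scaleR norm_triangle_ineq4)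
    moreover have "norm ((1/2) *\<^sub>R (a - b)) \<le> n"
      using a b norm_triangle_ineq4[of a b] by simp
    ultimately show ?thesis
      using a b by (intro exI[of _ "(1/2) *\<^sub>R (a - b)"]) linarith
  qed
  show thesis
  proof (rule that[of "2 * n / e"])
    fix y :: 'b and d :: real assume "d > 0"
    show "\<exists>x. norm x \<le> 2 * n / e * norm y \<and> norm (y - T x) < d"
    proof (cases "y = 0")
      case True
      then show ?thesis using \<open>d > 0\<close> by (intro exI[of _ 0]) (simp add: T.zero)
    next
      case False
      \<comment> \<open>Scaling by \<open>c\<close> gives \<open>y\<close> the norm
        \<open>e / 2\<close>, within reach of \<open>small\<close>.\<close>
      define c where "c = e / (2 * norm y)"
      have c: "c > 0" "norm (c *\<^sub>R y) < e"
        using False e by (simp_all add: c_def)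
      obtain x where x: "norm x \<le> n" "norm (c *\<^sub>R y - T x) < c * d"
        using small[OF c(2), of "c * d"] c \<open>d > 0\<close> by auto
      have "norm (c *\<^sub>R (y - T ((1/c) *\<^sub>R x))) < c * d"
        using x c by (simp add: T.scaleR scaleR_diff_right)
      then have "norm (y - T ((1/c) *\<^sub>R x)) < d"
        using c by simp
      moreover have "norm ((1/c) *\<^sub>R x) \<le> 2 * n / e * norm y"
        using x c e False by (simp add: c_def field_simps mult_left_mono)
      ultimately show ?thesis by blast
    qed
  qed
qed

text \<open>Successive approximation: each correction at least halves the remaining error, so the
  corrections form a geometrically dominated series that sums to an exact preimage. The
  \<open>max\<close> keeps the constant positive.\<close>

lemma surj_bounded_linear_preimage_bound:
  fixes T :: "'a::banach \<Rightarrow> 'b::banach"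
  assumes "bounded_linear T" and "surj T"
  obtains K where "K > 0" "\<And>y. \<exists>x. T x = y \<and> norm x \<le> K * norm y"
proof -
  interpret T: bounded_linear T by fact
  obtain K where K: "\<And>y e. e > 0 \<Longrightarrow> \<exists>x. norm x \<le> K * norm y \<and> norm (y - T x) < e"
    using surj_bounded_linear_approx[OF assms] by metis
  have "\<exists>x. norm x \<le> K * norm y \<and> norm (y - T x) \<le> norm y / 2" for y
  proof (cases "y = 0")
    case True
    then show ?thesis by (intro exI[of _ 0]) (simp add: T.zero)
  next
    case False
    then show ?thesis using K[of "norm y / 2" y] by force
  qed
  then obtain g where g: "\<And>y. norm (g y) \<le> K * norm y" "\<And>y. norm (y - T (g y)) \<le> norm y / 2"
    by metis
  have "\<exists>x. T x = y \<and> norm x \<le> max 1 (2 * K) * norm y" for y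
  proof -
    define r where "r n = ((\<lambda>y. y - T (g y)) ^^ n) y" for n
    have r0: "r 0 = y" and rS: "r (Suc n) = r n - T (g (r n))" for n
      by (simp_all add: r_def)
    have r: "norm (r n) \<le> norm y * (1/2) ^ n" for n
    proof (induction n)
      case (Suc n)
      then show ?case using g(2)[of "r n"] by (simp add: rS)
    qed (simp add: r0)
    have K0: "K \<ge> 0" if "y \<noteq> 0"
      using g(1)[of y] that by (smt (verit) norm_ge_zero zero_less_norm_iff mult_neg_pos)
    show ?thesis
    proof (cases "y = 0")
      case True
      then show ?thesis by (intro exI[of _ 0]) (simp add: T.zero)
    next
      case False
      have bd: "norm (g (r n)) \<le> K * norm y * (1/2) ^ n" for n
        using g(1)[of "r n"] mult_left_mono[OF r[of n] K0[OF False]] by simp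
      have sm: "summable (\<lambda>n. K * norm y * (1/2) ^ n)"
        by (intro summable_mult summable_geometric) simp
      have sg: "summable (\<lambda>n. g (r n))"
        by (rule summable_comparison_test'[OF sm, of 0]) (use bd in auto)
      have "T (\<Sum>n<N. g (r n)) = y - r N" for N
        by (induction N) (simp_all add: r0 rS T.zero T.add)
      moreover have "r \<longlonglongrightarrow> 0"
      proof (rule Lim_null_comparison)
        show "\<forall>\<^sub>F n in sequentially. norm (r n) \<le> norm y * (1/2) ^ n"
          using r by simp
        show "(\<lambda>n. norm y * (1/2) ^ n) \<longlonglongrightarrow> 0"
          by (intro tendsto_mult_right_zero LIMSEQ_realpow_zero) auto
      qed
      ultimately have "(\<lambda>N. T (\<Sum>n<N. g (r n))) \<longlonglongrightarrow> y"
        using tendsto_diff[OF tendsto_const[of y] \<open>r \<longlonglongrightarrow> 0\<close>] by simp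
      moreover have "(\<lambda>N. T (\<Sum>n<N. g (r n))) \<longlonglongrightarrow> T (\<Sum>n. g (r n))"
        by (intro T.tendsto summable_LIMSEQ sg)
      ultimately have "T (\<Sum>n. g (r n)) = y"
        using LIMSEQ_unique by blast
      moreover have "norm (\<Sum>n. g (r n)) \<le> (\<Sum>n. K * norm y * (1/2) ^ n)"
        by (rule norm_suminf_le[OF bd sm])
      moreover have "(\<Sum>n. K * norm y * (1/2::real) ^ n) = 2 * K * norm y"
        by (subst suminf_mult) (simp_all add: suminf_geometric)
      moreover have "2 * K * norm y \<le> max 1 (2 * K) * norm y"
        by (intro mult_right_mono) auto
      ultimately show ?thesis by force
    qed
  qed
  then show thesis using that[of "max 1 (2 * K)"] by simp
qed

text \<open>For a point \<open>x\<close> outside \<open>M\<close>, the parallelogram law makes a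
  distance-minimizing sequence in \<open>M\<close> Cauchy. Its limit \<open>p\<close> is nearest to
  \<open>x\<close>, and minimality makes \<open>x - p\<close> orthogonal to
  \<open>M\<close>.\<close>

lemma exists_orthogonal_to_closed_subspace:
  fixes M :: "'a::{real_inner,banach} set"
  assumes "subspace M" and "closed M" and "M \<noteq> UNIV"
  obtains y where "y \<noteq> 0" "\<And>m. m \<in> M \<Longrightarrow> inner m y = 0"
proof -
  obtain x where x: "x \<notin> M" using assms by auto
  have M0: "0 \<in> M" using assms by (simp add: subspace_0)
  define d where "d = infdist x M"
  have d: "d \<le> norm (x - m)" if "m \<in> M" for m
    using infdist_le[OF that, of x] by (simp add: d_def dist_norm)
  have d0: "d \<ge> 0" by (simp add: d_def infdist_nonneg)
  have "\<exists>m\<in>M. norm (x - m) < d + 1 / real (Suc n)" for n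
  proof (rule ccontr)
    assume "\<not> ?thesis"
    then have "d + 1 / real (Suc n) \<le> infdist x M"
      using M0 by (subst infdist_notempty) (auto simp: dist_norm not_less intro!: cINF_greatest)
    then show False by (simp add: d_def)
  qed
  then obtain m where m: "\<And>n. m n \<in> M" "\<And>n. norm (x - m n) < d + 1 / real (Suc n)"
    by metis
  have par: "(norm (m i - m j))\<^sup>2 \<le> 4 * (d + e)\<^sup>2 - 4 * d\<^sup>2"
    if "norm (x - m i) \<le> d + e" "norm (x - m j) \<le> d + e" for i j e
  proof -
    have "(1/2) *\<^sub>R (m i + m j) \<in> M"
      using m assms by (simp add: subspace_add subspace_scale)
    then have "d \<le> norm (x - (1/2) *\<^sub>R (m i + m j))" by (rule d)
    then have 1: "d\<^sup>2 \<le> (norm (x - (1/2) *\<^sub>R (m i + m j)))\<^sup>2"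
      using d0 by (simp add: power_mono)
    have 2: "(norm (m i - m j))\<^sup>2 + 4 * (norm (x - (1/2) *\<^sub>R (m i + m j)))\<^sup>2
        = 2 * (norm (x - m i))\<^sup>2 + 2 * (norm (x - m j))\<^sup>2"
      by (simp add: power2_norm_eq_inner inner_commute inner_diff_left inner_diff_right
          inner_add_left inner_add_right algebra_simps)
    have "(norm (x - m i))\<^sup>2 \<le> (d + e)\<^sup>2" "(norm (x - m j))\<^sup>2 \<le> (d + e)\<^sup>2"
      using that by (simp_all add: power_mono)
    then show ?thesis using 1 2 by linarith
  qed
  have "Cauchy m"
  proof (rule metric_CauchyI)
    fix e :: real assume "e > 0"
    have "(\<lambda>n. 4 * (d + 1 / real (Suc n))\<^sup>2 - 4 * d\<^sup>2) \<longlonglongrightarrow> 4 * (d + 0)\<^sup>2 - 4 * d\<^sup>2"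
      by (intro tendsto_intros LIMSEQ_Suc[OF lim_1_over_n])
    then have "\<forall>\<^sub>F n in sequentially. 4 * (d + 1 / real (Suc n))\<^sup>2 - 4 * d\<^sup>2 < e\<^sup>2"
      using \<open>e > 0\<close> by (intro order_tendstoD(2)) auto
    then obtain N where N: "4 * (d + 1 / real (Suc N))\<^sup>2 - 4 * d\<^sup>2 < e\<^sup>2"
      by (meson eventually_happens sequentially_bot)
    have le: "norm (x - m i) \<le> d + 1 / real (Suc N)" if "i \<ge> N" for i
    proof -
      have "1 / real (Suc i) \<le> 1 / real (Suc N)"
        using that by (simp add: frac_le)
      then show ?thesis using m(2)[of i] by linarith
    qed
    have "dist (m i) (m j) < e" if "i \<ge> N" "j \<ge> N" for i j
    proof -
      have "(norm (m i - m j))\<^sup>2 < e\<^sup>2"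
        using par[OF le le] that N by force
      then show ?thesis
        using \<open>e > 0\<close> by (simp add: dist_norm power2_less_imp_less)
    qed
    then show "\<exists>N. \<forall>i\<ge>N. \<forall>j\<ge>N. dist (m i) (m j) < e" by blast
  qed
  then obtain p where p: "m \<longlonglongrightarrow> p"
    using Cauchy_convergent convergent_def by blast
  have pM: "p \<in> M"
    using \<open>closed M\<close> closed_sequentially m(1) p by blast
  have "norm (x - p) \<le> d + 0"
  proof (rule LIMSEQ_le)
    show "(\<lambda>n. norm (x - m n)) \<longlonglongrightarrow> norm (x - p)"
      by (intro tendsto_intros p)
    show "(\<lambda>n. d + 1 / real (Suc n)) \<longlonglongrightarrow> d + 0"
      by (intro tendsto_intros LIMSEQ_Suc[OF lim_1_over_n])
    show "\<exists>N. \<forall>n\<ge>N. norm (x - m n) \<le> d + 1 / real (Suc n)"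
      using m(2) less_imp_le by blast
  qed
  then have min: "norm (x - p) \<le> norm (x - p - u)" if "u \<in> M" for u
    using d[of "p + u"] pM that assms by (simp add: subspace_add diff_diff_eq)
  show thesis
  proof (rule that[of "x - p"])
    show "x - p \<noteq> 0" using x pM by auto
    fix u assume u: "u \<in> M"
    show "inner u (x - p) = 0"
    proof (cases "u = 0")
      case False
      \<comment> \<open>This value minimizes the norm of \<open>x - p - t *\<^sub>R u\<close> over
        real \<open>t\<close>; comparison with \<open>t = 0\<close> forces the inner product to
        vanish.\<close>
      define t where "t = inner u (x - p) / inner u u"
      have "t *\<^sub>R u \<in> M" using u assms by (simp add: subspace_scale)
      then have "(norm (x - p))\<^sup>2 \<le> (norm (x - p - t *\<^sub>R u))\<^sup>2"
        by (intro power_mono min) auto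
      then have "2 * t * inner u (x - p) \<le> t * t * inner u u"
        unfolding power2_norm_eq_inner
        by (simp add: inner_commute inner_diff_left inner_diff_right algebra_simps)
      also have "t * t * inner u u = t * inner u (x - p)"
        using False by (simp add: t_def)
      finally have "t * inner u (x - p) \<le> 0"
        by simp
      then have "(inner u (x - p))\<^sup>2 / inner u u \<le> 0"
        by (simp add: t_def power2_eq_square)
      then show ?thesis
        using False by (simp add: divide_le_0_iff)
         (smt (verit) inner_gt_zero_iff zero_le_power2 power_eq_0_iff)
    qed simp
  qed
qed

section \<open>Bounded complex linear maps\<close>

lemma norm_scaleC [simp]: "norm (a *\<^sub>C (x::'a::complex_inner)) = cmod a * norm x"
proof -
  have "cinner x (a *\<^sub>C x) = cnj a * cinner x x"
    by (metis cinner_commute cinner_scaleC_left complex_cnj_mult)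
  then have "cinner (a *\<^sub>C x) (a *\<^sub>C x) = (a * cnj a) * cinner x x"
    by (simp add: cinner_scaleC_left mult.assoc)
  also have "a * cnj a = complex_of_real ((cmod a)\<^sup>2)"
    by (metis complex_norm_square)
  finally have "inner (a *\<^sub>C x) (a *\<^sub>C x) = (cmod a)\<^sup>2 * inner x x"
    by (simp add: inner_cinner)
  then have "(norm (a *\<^sub>C x))\<^sup>2 = (cmod a * norm x)\<^sup>2"
    by (simp add: power2_norm_eq_inner power_mult_distrib)
  then show ?thesis
    by (metis abs_of_nonneg mult_nonneg_nonneg norm_ge_zero power2_eq_iff_nonneg)
qed

lemma bounded_linear_cinner_left: "bounded_linear (\<lambda>x::'a::complex_inner. cinner x y)"
proof (rule bounded_linear_intro[of _ "2 * norm y"])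
  fix x z :: 'a and r :: real
  show "cinner (x + z) y = cinner x y + cinner z y"
    by (rule cinner_add_left)
  show "cinner (r *\<^sub>R x) y = r *\<^sub>R cinner x y"
    by (simp add: scaleR_scaleC cinner_scaleC_left scaleR_conv_of_real)
  \<comment> \<open>Multiplication by the imaginary unit turns the imaginary part into a real inner
    product, so Cauchy-Schwarz bounds both parts; adding them costs the factor 2.\<close>
  have "Re (cinner x y) = inner x y" "Im (cinner x y) = - inner (\<i> *\<^sub>C x) y"
    by (simp_all add: inner_cinner cinner_scaleC_left)
  moreover have "\<bar>inner x y\<bar> \<le> norm x * norm y" "\<bar>inner (\<i> *\<^sub>C x) y\<bar> \<le> norm x * norm y"
    using Cauchy_Schwarz_ineq2[of x y] Cauchy_Schwarz_ineq2[of "\<i> *\<^sub>C x" y] by simp_all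
  ultimately show "norm (cinner x y) \<le> norm x * (2 * norm y)"
    using cmod_le[of "cinner x y"] by (simp add: algebra_simps)
qed

lemma cinner_zero_left [simp]: "cinner 0 (y::'a::complex_inner) = 0"
  using bounded_linear.linear[OF bounded_linear_cinner_left] by (rule linear_0)

lemma cinner_zero_right [simp]: "cinner (x::'a::complex_inner) 0 = 0"
  by (subst cinner_commute) simp

lemma cinner_eq_zero_iff: "cinner x x = 0 \<longleftrightarrow> x = (0::'a::complex_inner)"
proof
  assume "cinner x x = 0"
  then have "inner x x = 0" by (simp add: inner_cinner)
  then show "x = 0" by simp
qed simp

lemma bounded_clinearD:
  assumes "bounded_clinear f"
  shows "bounded_linear f" and "f (a *\<^sub>C x) = a *\<^sub>C f x"
    and "f (x + y) = f x + f y" and "f (x - y) = f x - f y" and "f 0 = 0"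
  using assms linear_simps[of f]
  by (simp_all add: bounded_clinear_def linear_0 bounded_linear.linear)

lemma bounded_clinear_compose:
  assumes "bounded_clinear g" and "bounded_clinear f"
  shows "bounded_clinear (\<lambda>x. g (f x))"
  using assms by (simp add: bounded_clinear_def bounded_linear_compose)

lemma bounded_linear_scaleC: "bounded_linear (\<lambda>x::'a::complex_inner. a *\<^sub>C x)"
  by (rule bounded_linear_intro[of _ "cmod a"])
    (simp_all add: scaleC_add_right scaleR_scaleC scaleC_scaleC mult.commute)

lemma bounded_clinear_shifted:
  assumes "bounded_clinear T"
  shows "bounded_clinear (shifted T w)"
  using assms
  by (auto simp: bounded_clinear_def shifted_def complex_vector.scale_right_diff_distrib
      complex_vector.scale_left_commute
      intro!: bounded_linear_sub bounded_linear_scaleC)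

lemma subspace_closure:
  fixes M :: "'a::real_normed_vector set"
  assumes "subspace M"
  shows "subspace (closure M)"
  unfolding subspace_def
proof safe
  show "0 \<in> closure M"
    using assms closure_subset subspace_0 by blast
  fix x y assume "x \<in> closure M" "y \<in> closure M"
  then obtain f g where "\<And>n. f n \<in> M" "f \<longlonglongrightarrow> x" "\<And>n. g n \<in> M" "g \<longlonglongrightarrow> y"
    unfolding closure_sequential by blast
  then show "x + y \<in> closure M"
    unfolding closure_sequential using assms
    by (intro exI[of _ "\<lambda>n. f n + g n"]) (simp add: tendsto_add subspace_add)
next
  fix c x assume "x \<in> closure M"
  then obtain f where "\<And>n. f n \<in> M" "f \<longlonglongrightarrow> x"
    unfolding closure_sequential by blast
  then show "c *\<^sub>R x \<in> closure M"
    unfolding closure_sequential using assms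
    by (intro exI[of _ "\<lambda>n. c *\<^sub>R f n"]) (simp add: tendsto_scaleR subspace_scale)
qed

text \<open>The real projection argument gives only real orthogonality. The range is stable under
  multiplication by the imaginary unit, which kills the imaginary part of the inner product as
  well.\<close>

lemma exists_cinner_orthogonal_to_range:
  fixes X :: "'a::complex_hilbert \<Rightarrow> 'b::complex_hilbert"
  assumes "bounded_clinear X" and "closure (range X) \<noteq> UNIV"
  obtains y where "y \<noteq> 0" "\<And>x. cinner (X x) y = 0"
proof -
  note X = bounded_clinearD[OF assms(1)]
  have "subspace (range X)"
    using linear_subspace_image[OF bounded_linear.linear[OF X(1)] subspace_UNIV] .
  then have "subspace (closure (range X))"
    by (rule subspace_closure)
  then obtain y where y: "y \<noteq> 0" "\<And>m. m \<in> closure (range X) \<Longrightarrow> inner m y = 0"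
    using exists_orthogonal_to_closed_subspace[OF _ closed_closure assms(2)] by metis
  have "Re (cinner (X x) y) = 0" for x
    using y(2)[of "X x"] closure_subset[of "range X"] by (force simp: inner_cinner)
  from this this[of "\<i> *\<^sub>C _"] have "cinner (X x) y = 0" for x
    by (simp add: X(2) cinner_scaleC_left complex_eq_iff)
  with y(1) show thesis by (rule that)
qed

lemma bounded_linear_eq_zero_on_dense:
  fixes f :: "'a::real_normed_vector \<Rightarrow> 'b::real_normed_vector"
  assumes "bounded_linear f" and "closure A = UNIV" and "\<And>x. x \<in> A \<Longrightarrow> f x = 0"
  shows "f x = 0"
proof -
  have "closed (f -` {0})"
    by (intro closed_vimage closed_singleton linear_continuous_on assms(1))
  then have "closure A \<subseteq> f -` {0}"
    using assms(3) by (intro closure_minimal) auto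
  then show ?thesis using assms(2) by auto
qed

section \<open>Eigenvectors of operators in the Cowen-Douglas class\<close>

lemma B1_D:
  assumes "T \<in> B1 \<Omega>"
  shows "bounded_clinear T"
    and "w \<in> \<Omega> \<Longrightarrow> surj (shifted T w)"
    and "closure (complex_vector.span (\<Union>w\<in>\<Omega>. kernel (shifted T w))) = UNIV"
    and "w \<in> \<Omega> \<Longrightarrow> complex_vector.dim (kernel (shifted T w)) = 1"
  using assms by (auto simp: B1_def)

lemma B1_eigenvector_exists:
  assumes "T \<in> B1 \<Omega>" and "w \<in> \<Omega>"
  obtains v where "v \<in> kernel (shifted T w)" "v \<noteq> 0"
proof -
  have "\<not> kernel (shifted T w) \<subseteq> {0}"
  proof
    assume "kernel (shifted T w) \<subseteq> {0}"
    then have "complex_vector.dim (kernel (shifted T w)) \<le> card ({} :: 'a set)"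
      by (intro complex_vector.dim_le_card) auto
    then show False using B1_D(4)[OF assms] by simp
  qed
  then show thesis using that by blast
qed

lemma B1_eigenvector_multiple:
  assumes "T \<in> B1 \<Omega>" and "w \<in> \<Omega>"
    and "v \<in> kernel (shifted T w)" and "v \<noteq> 0" and "x \<in> kernel (shifted T w)"
  obtains a where "x = a *\<^sub>C v"
proof -
  obtain B where B: "kernel (shifted T w) \<subseteq> complex_vector.span B" "card B = 1"
    by (metis B1_D(4)[OF assms(1,2)] complex_vector.basis_exists)
  then obtain b where b: "B = {b}"
    using card_1_singletonE by metis
  obtain c d where cd: "v = c *\<^sub>C b" "x = d *\<^sub>C b"
    using B(1) assms unfolding b complex_vector.span_singleton by blast
  moreover have "c \<noteq> 0"
    using \<open>v \<noteq> 0\<close> cd by auto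
  ultimately have "x = (d / c) *\<^sub>C v"
    by simp
  then show thesis by (rule that)
qed

text \<open>The eigenvectors span a dense subspace and \<open>f\<close> is continuous. Complex
  homogeneity is asked of the zero set alone, so that both operators and functionals such as
  \<open>\<lambda>x. cinner x y\<close> are covered.\<close>

lemma eq_zero_if_zero_on_eigenvectors:
  fixes f :: "'a::complex_hilbert \<Rightarrow> 'b::real_normed_vector"
  assumes "T \<in> B1 \<Omega>" and f: "bounded_linear f" "\<And>a x. f x = 0 \<Longrightarrow> f (a *\<^sub>C x) = 0"
    and zero: "\<And>w x. w \<in> \<Omega> \<Longrightarrow> x \<in> kernel (shifted T w) \<Longrightarrow> f x = 0"
  shows "f x = 0"
proof (rule bounded_linear_eq_zero_on_dense[OF f(1) B1_D(3)[OF assms(1)]])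
  fix x assume "x \<in> complex_vector.span (\<Union>w\<in>\<Omega>. kernel (shifted T w))"
  then show "f x = 0"
  proof (rule complex_vector.span_induct)
    show "complex_vector.subspace {x. f x = 0}"
      using linear_simps[OF f(1)] f(2)
      by (auto simp: complex_vector.subspace_def linear_0 bounded_linear.linear f(1))
  qed (use zero in auto)
qed

text \<open>The section is \<open>\<gamma> w = (\<Sum>n. (w - w\<^sub>0)^n u\<^sub>n)\<close> with \<open>u\<^sub>0 = v\<close> and \<open>(T - w\<^sub>0) u\<^sub>n\<^sub>+\<^sub>1 = u\<^sub>n\<close>;
  the open mapping theorem gives \<open>\<parallel>u\<^sub>n\<parallel> \<le> K^n \<parallel>v\<parallel>\<close>.\<close>

lemma holomorphic_eigenvector_section:
  fixes T :: "'a::complex_hilbert \<Rightarrow> 'a"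
  assumes T: "bounded_clinear T" and surj: "surj (shifted T w0)"
    and v: "v \<in> kernel (shifted T w0)"
  obtains r \<gamma> where "r > 0" "\<gamma> w0 = v" "\<And>w. w \<in> ball w0 r \<Longrightarrow> \<gamma> w \<in> kernel (shifted T w)"
    "\<And>f. bounded_linear f \<Longrightarrow> (\<And>a x. f (a *\<^sub>C x) = a * f x) \<Longrightarrow>
      (\<lambda>w. f (\<gamma> w)) holomorphic_on ball w0 r"
proof -
  let ?A = "shifted T w0"
  note A = bounded_clinearD[OF bounded_clinear_shifted[OF T, of w0]]
  obtain K where K: "K > 0" "\<And>y. \<exists>x. ?A x = y \<and> norm x \<le> K * norm y"
    using surj_bounded_linear_preimage_bound[OF A(1) surj] by metis
  then obtain g where g: "\<And>y. ?A (g y) = y" "\<And>y. norm (g y) \<le> K * norm y"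
    by metis
  define u where "u n = (g ^^ n) v" for n
  have u0: "u 0 = v" and Au: "?A (u (Suc n)) = u n" for n
    by (simp_all add: u_def g)
  have nu: "norm (u n) \<le> K ^ n * norm v" for n
  proof (induction n)
    case (Suc n)
    have "norm (u (Suc n)) \<le> K * norm (u n)" by (simp add: u_def g)
    also have "\<dots> \<le> K * (K ^ n * norm v)"
      using Suc K by (intro mult_left_mono) auto
    finally show ?case by simp
  qed (simp add: u0)
  define \<gamma> where "\<gamma> w = (\<Sum>n. (w - w0) ^ n *\<^sub>C u n)" for w
  have sums: "(\<lambda>n. (w - w0) ^ n *\<^sub>C u n) sums \<gamma> w" if w: "w \<in> ball w0 (1 / K)" for w
  proof -
    have "cmod (w - w0) * K < 1"
      using w K by (simp add: dist_norm norm_minus_commute field_simps)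
    then have "summable (\<lambda>n. norm v * (cmod (w - w0) * K) ^ n)"
      using K by (intro summable_mult summable_geometric) simp
    moreover have "norm ((w - w0) ^ n *\<^sub>C u n) \<le> norm v * (cmod (w - w0) * K) ^ n" for n
      using mult_left_mono[OF nu[of n], of "cmod (w - w0) ^ n"]
      by (simp add: norm_power power_mult_distrib algebra_simps)
    ultimately have "summable (\<lambda>n. (w - w0) ^ n *\<^sub>C u n)"
      by (rule summable_comparison_test'[of _ 0])
    then show ?thesis by (simp add: \<gamma>_def summable_sums)
  qed
  show thesis
  proof (rule that[of "1 / K" \<gamma>])
    show "1 / K > 0" using K by simp
    have "(\<lambda>n. (w0 - w0) ^ n *\<^sub>C u n) sums ((w0 - w0) ^ 0 *\<^sub>C u 0)"
      by (rule sums_single[of 0, THEN sums_cong[THEN iffD1, rotated]]) auto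
    then show "\<gamma> w0 = v"
      by (simp add: \<gamma>_def sums_unique[symmetric] u0 scaleC_one)
  next
    fix w assume w: "w \<in> ball w0 (1 / K)"
    have "(\<lambda>n. ?A ((w - w0) ^ n *\<^sub>C u n)) sums ?A (\<gamma> w)"
      by (rule bounded_linear.sums[OF A(1) sums[OF w]])
    \<comment> \<open>The zeroth term splits off because \<open>?A\<close> annihilates
      \<open>u 0\<close>; after the index shift each term is \<open>w - w0\<close> times a term of
      the original series.\<close>
    then have "(\<lambda>n. ?A ((w - w0) ^ Suc n *\<^sub>C u (Suc n))) sums (?A (\<gamma> w) - ?A ((w - w0) ^ 0 *\<^sub>C u 0))"
      by (subst sums_Suc_iff) simp
    moreover have "?A ((w - w0) ^ Suc n *\<^sub>C u (Suc n)) = (w - w0) *\<^sub>C ((w - w0) ^ n *\<^sub>C u n)" for n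
      by (simp add: A(2) Au scaleC_scaleC)
    moreover have "?A (u 0) = 0"
      using v by (simp add: u0 kernel_def)
    ultimately have "(\<lambda>n. (w - w0) *\<^sub>C ((w - w0) ^ n *\<^sub>C u n)) sums ?A (\<gamma> w)"
      by (simp only: A(2) complex_vector.scale_zero_right diff_zero)
    moreover have "(\<lambda>n. (w - w0) *\<^sub>C ((w - w0) ^ n *\<^sub>C u n)) sums ((w - w0) *\<^sub>C \<gamma> w)"
      by (rule bounded_linear.sums[OF bounded_linear_scaleC sums[OF w]])
    ultimately have "?A (\<gamma> w) = (w - w0) *\<^sub>C \<gamma> w"
      by (rule sums_unique2)
    then show "\<gamma> w \<in> kernel (shifted T w)"
      by (simp add: kernel_def shifted_def complex_vector.scale_left_diff_distrib)
  next
    fix f :: "'a \<Rightarrow> complex"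
    assume f: "bounded_linear f" "\<And>a x. f (a *\<^sub>C x) = a * f x"
    \<comment> \<open>Under a functional the section becomes an ordinary complex power series; this
      weak holomorphy is what the continuation of \<open>cinner (\<gamma> w) y\<close>
      needs.\<close>
    show "(\<lambda>w. f (\<gamma> w)) holomorphic_on ball w0 (1 / K)"
    proof (rule power_series_holomorphic)
      fix w assume "w \<in> ball w0 (1 / K)"
      from bounded_linear.sums[OF f(1) sums[OF this]]
      show "(\<lambda>n. f (u n) * (w - w0) ^ n) sums f (\<gamma> w)"
        by (simp add: f(2) mult.commute)
    qed
  qed
qed

section \<open>Intertwining operators\<close>

lemma intertwiner_maps_eigenvectors:
  assumes "bounded_clinear X" and "\<And>x. X (T x) = T' (X x)" and "x \<in> kernel (shifted T w)"
  shows "X x \<in> kernel (shifted T' w)"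
  using assms(3) bounded_clinearD[OF assms(1)] assms(2)[of x] by (simp add: kernel_def shifted_def)

text \<open>The pairing of \<open>X (\<gamma> w)\<close> with the fixed vector \<open>X v\<close> is
  continuous and nonzero at \<open>w0\<close>, hence nonzero nearby. With the identity as
  \<open>X\<close> this yields a section without zeros.\<close>

lemma nonvanishing_eigenvector_section:
  fixes T :: "'a::complex_hilbert \<Rightarrow> 'a" and X :: "'a \<Rightarrow> 'b::complex_hilbert"
  assumes "open \<Omega>" and T: "T \<in> B1 \<Omega>" and w0: "w0 \<in> \<Omega>"
    and v: "v \<in> kernel (shifted T w0)" and X: "bounded_clinear X" and "X v \<noteq> 0"
  obtains r \<gamma> where "r > 0" "ball w0 r \<subseteq> \<Omega>" "\<And>w. w \<in> ball w0 r \<Longrightarrow> \<gamma> w \<in> kernel (shifted T w)"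
    "\<And>w. w \<in> ball w0 r \<Longrightarrow> X (\<gamma> w) \<noteq> 0" "\<And>y. (\<lambda>w. cinner (\<gamma> w) y) holomorphic_on ball w0 r"
proof -
  note Xl = bounded_clinearD[OF X]
  obtain r \<gamma> where r: "r > 0" "\<gamma> w0 = v" "\<And>w. w \<in> ball w0 r \<Longrightarrow> \<gamma> w \<in> kernel (shifted T w)"
    and hol: "\<And>f. bounded_linear f \<Longrightarrow> (\<And>a x. f (a *\<^sub>C x) = a * f x) \<Longrightarrow>
      (\<lambda>w. f (\<gamma> w)) holomorphic_on ball w0 r"
    using holomorphic_eigenvector_section[OF B1_D(1)[OF T] B1_D(2)[OF T w0] v] by metis
  define h where "h w = cinner (X (\<gamma> w)) (X v)" for w
  define G where "G = (ball w0 r \<inter> \<Omega>) \<inter> h -` (- {0})"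
  have "h holomorphic_on ball w0 r"
    unfolding h_def
    by (rule hol) (simp_all add: Xl cinner_scaleC_left
        bounded_linear_compose[OF bounded_linear_cinner_left Xl(1)])
  then have "continuous_on (ball w0 r \<inter> \<Omega>) h"
    by (meson holomorphic_on_imp_continuous_on continuous_on_subset inf_le1)
  then have "open G"
    unfolding G_def using \<open>open \<Omega>\<close> by (intro continuous_open_preimage) auto
  moreover have "w0 \<in> G"
    using r w0 \<open>X v \<noteq> 0\<close> by (simp add: G_def h_def cinner_eq_zero_iff)
  ultimately obtain s where s: "s > 0" "ball w0 s \<subseteq> G"
    using open_contains_ball by blast
  have "X (\<gamma> w) \<noteq> 0" if "w \<in> ball w0 s" for w
    using that s by (auto simp: G_def h_def)
  moreover have "(\<lambda>w. cinner (\<gamma> w) y) holomorphic_on ball w0 s" for y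
    by (rule holomorphic_on_subset[OF hol[OF bounded_linear_cinner_left cinner_scaleC_left]])
      (use s in \<open>auto simp: G_def\<close>)
  ultimately show thesis
    using s r(3) by (intro that[of s \<gamma>]) (auto simp: G_def)
qed

text \<open>If \<open>y\<close> is orthogonal to the range of \<open>X\<close>, then it is orthogonal to the eigenvectors of \<open>T'\<close> near
  a point where \<open>X\<close> does not kill the eigenvectors of \<open>T\<close>; analytic continuation spreads this over
  \<open>\<Omega>\<close>.\<close>

lemma nonzero_intertwiner_dense_range:
  fixes T :: "'a::complex_hilbert \<Rightarrow> 'a" and T' :: "'b::complex_hilbert \<Rightarrow> 'b"
  assumes "open \<Omega>" and "connected \<Omega>" and T: "T \<in> B1 \<Omega>" and T': "T' \<in> B1 \<Omega>"
    and X: "bounded_clinear X" and XT: "\<And>x. X (T x) = T' (X x)" and "X x0 \<noteq> 0"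
  shows "closure (range X) = UNIV"
proof (rule ccontr)
  assume "closure (range X) \<noteq> UNIV"
  then obtain y where y: "y \<noteq> 0" "\<And>x. cinner (X x) y = 0"
    using exists_cinner_orthogonal_to_range[OF X] by metis
  note Xl = bounded_clinearD[OF X]
  define Z where "Z = {w. \<forall>x\<in>kernel (shifted T' w). cinner x y = 0}"
  \<comment> \<open>One nonzero eigenvector orthogonal to \<open>y\<close> suffices, since the
    eigenspace is a line.\<close>
  have ZI: "w \<in> Z" if w: "w \<in> \<Omega>" "x \<in> kernel (shifted T' w)" "x \<noteq> 0" "cinner x y = 0" for w x
    unfolding Z_def
  proof safe
    fix x' assume "x' \<in> kernel (shifted T' w)"
    then obtain a where "x' = a *\<^sub>C x"
      using B1_eigenvector_multiple[OF T' w(1,2,3)] by metis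
    then show "cinner x' y = 0" by (simp add: w cinner_scaleC_left)
  qed
  obtain w1 v where w1: "w1 \<in> \<Omega>" and v: "v \<in> kernel (shifted T w1)" "X v \<noteq> 0"
    using eq_zero_if_zero_on_eigenvectors[OF T Xl(1)] Xl(2) \<open>X x0 \<noteq> 0\<close>
    by (metis complex_vector.scale_zero_right)
  obtain r \<gamma> where r: "r > 0" "ball w1 r \<subseteq> \<Omega>" "\<And>w. w \<in> ball w1 r \<Longrightarrow> \<gamma> w \<in> kernel (shifted T w)"
    "\<And>w. w \<in> ball w1 r \<Longrightarrow> X (\<gamma> w) \<noteq> 0"
    using nonvanishing_eigenvector_section[OF \<open>open \<Omega>\<close> T w1 v(1) X v(2)] by metis
  have "w \<in> Z" if "w \<in> ball w1 r" for w
    using that r y intertwiner_maps_eigenvectors[of X T T', OF X XT]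
    by (intro ZI[of w "X (\<gamma> w)"]) auto
  then have "w1 \<in> interior Z"
    using \<open>r > 0\<close> by (meson mem_interior subsetI)
  \<comment> \<open>Relative closedness of \<open>interior Z\<close> in \<open>\<Omega>\<close>:
    near a limit point \<open>w0\<close> the function \<open>cinner (\<gamma> w) y\<close> vanishes
    on a nonempty open set, hence on the whole ball by the identity theorem.\<close>
  have closed: "w0 \<in> interior Z" if w0: "w0 \<in> \<Omega>" "w0 \<in> closure (interior Z)" for w0
  proof -
    obtain v where v: "v \<in> kernel (shifted T' w0)" "v \<noteq> 0"
      using B1_eigenvector_exists[OF T' w0(1)] by metis
    have "bounded_clinear (\<lambda>x::'b. x)"
      by (simp add: bounded_clinear_def bounded_linear_ident)
    then obtain r \<gamma> where r: "r > 0" "ball w0 r \<subseteq> \<Omega>"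
      "\<And>w. w \<in> ball w0 r \<Longrightarrow> \<gamma> w \<in> kernel (shifted T' w)"
      "\<And>w. w \<in> ball w0 r \<Longrightarrow> \<gamma> w \<noteq> 0" "\<And>y. (\<lambda>w. cinner (\<gamma> w) y) holomorphic_on ball w0 r"
      using nonvanishing_eigenvector_section[of \<Omega> T' w0 v "\<lambda>x. x"] \<open>open \<Omega>\<close> T' w0(1) v by metis
    have zero: "cinner (\<gamma> w) y = 0" if w: "w \<in> ball w0 r" for w
    proof (rule analytic_continuation_open[where s = "ball w0 r \<inter> interior Z" and s' = "ball w0 r"
          and f = "\<lambda>w. cinner (\<gamma> w) y" and g = "\<lambda>_. 0"])
      show "ball w0 r \<inter> interior Z \<noteq> {}"
        using \<open>w0 \<in> closure (interior Z)\<close> \<open>r > 0\<close>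
        by (metis centre_in_ball disjoint_iff open_ball open_Int_closure_eq_empty)
      fix z assume "z \<in> ball w0 r \<inter> interior Z"
      then show "cinner (\<gamma> z) y = 0"
        using r(3) interior_subset[of Z] by (auto simp: Z_def)
    qed (use w r(5) in auto)
    have "w \<in> Z" if "w \<in> ball w0 r" for w
      using that r zero by (intro ZI[of w "\<gamma> w"]) auto
    then show ?thesis
      using \<open>r > 0\<close> by (meson mem_interior subsetI)
  qed
  have "\<Omega> \<subseteq> interior Z"
  proof (rule ccontr)
    assume "\<not> \<Omega> \<subseteq> interior Z"
    moreover have "interior Z \<inter> \<Omega> \<noteq> {}"
      using w1 \<open>w1 \<in> interior Z\<close> by blast
    moreover have "\<Omega> \<subseteq> interior Z \<union> - closure (interior Z)"
      using closed by blast
    ultimately show False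
      using connectedD[OF \<open>connected \<Omega>\<close> open_interior[of Z], of "- closure (interior Z)"]
        closure_subset[of "interior Z"] by blast
  qed
  then have "cinner x y = 0" if "w \<in> \<Omega>" "x \<in> kernel (shifted T' w)" for w x
    using that interior_subset[of Z] by (auto simp: Z_def)
  \<comment> \<open>By density of the span of the eigenvectors, \<open>y\<close> is orthogonal to
    everything, in particular to itself.\<close>
  then have "cinner y y = 0"
    using eq_zero_if_zero_on_eigenvectors[OF T' bounded_linear_cinner_left[of y]]
    by (simp add: cinner_scaleC_left)
  then show False using y by (simp add: cinner_eq_zero_iff)
qed

text \<open>The induction uses \<open>A\<^sup>n W = W A\<^sup>n - n N A\<^sup>n\<^sup>-\<^sup>1\<close>, valid because \<open>A\<close> commutes with \<open>N\<close>.\<close>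

lemma commutator_power_identity:
  fixes A W N :: "'a::real_vector \<Rightarrow> 'a"
  assumes A: "linear A" and W: "linear W" and N: "linear N"
    and AW: "\<And>x. A (W x) = W (A x) - N x" and AN: "\<And>x. A (N x) = N (A x)" and "A v = 0"
  shows "(A ^^ n) ((W ^^ n) v) = (- 1) ^ n *\<^sub>R fact n *\<^sub>R (N ^^ n) v"
proof -
  have AnN: "(A ^^ n) (N x) = N ((A ^^ n) x)" for n x
    by (induction n) (simp_all add: AN)
  have AnW: "(A ^^ Suc n) (W x) = W ((A ^^ Suc n) x) - real (Suc n) *\<^sub>R N ((A ^^ n) x)" for n x
  proof (induction n)
    case 0
    then show ?case by (simp add: AW)
  next
    case (Suc n)
    have "(A ^^ Suc (Suc n)) (W x) = A (W ((A ^^ Suc n) x)) - real (Suc n) *\<^sub>R A (N ((A ^^ n) x))"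
      using Suc by (simp add: linear_diff[OF A] linear_scale[OF A])
    then show ?case by (simp add: AW AN algebra_simps scaleR_2)
  qed
  \<comment> \<open>Moving powers of \<open>A\<close> past one \<open>W\<close> costs at most one
    \<open>A\<close>, so \<open>m\<close> copies of \<open>W\<close> absorb at most \<open>m\<close>
    of them; a surplus \<open>A\<close> reaches \<open>v\<close> and kills it.\<close>
  have zero: "n > m \<Longrightarrow> (A ^^ n) ((W ^^ m) v) = 0" for n m
  proof (induction m arbitrary: n)
    case 0
    then obtain k where k: "n = Suc k" by (cases n) auto
    have "(A ^^ k) 0 = 0" by (induction k) (simp_all add: linear_0[OF A])
    then show ?case
      using \<open>A v = 0\<close> by (simp add: k funpow_Suc_right del: funpow.simps)
  next
    case (Suc m)
    then obtain k where "n = Suc k" "k > m" by (cases n) auto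
    then show ?case
      using Suc.IH[of "Suc k"] Suc.IH[of k]
      by (simp add: AnW linear_0[OF W] linear_0[OF N] del: funpow.simps(2) add: funpow.simps(2)[of m W])
  qed
  show ?thesis
  proof (induction n)
    case (Suc n)
    \<comment> \<open>In \<open>AnW\<close> at \<open>(W ^^ n) v\<close> the first term has a
      surplus \<open>A\<close> and vanishes; the \<open>N\<close> term contributes the next factor
      of the factorial and the sign.\<close>
    have "(A ^^ Suc n) ((W ^^ Suc n) v) = - (real (Suc n) *\<^sub>R N ((A ^^ n) ((W ^^ n) v)))"
      using zero[of n "Suc n"]
      by (simp add: AnW linear_0[OF W] del: funpow.simps(2) add: funpow.simps(2)[of n W])
    then show ?case
      by (simp add: Suc linear_scale[OF N] del: of_nat_Suc)
  qed simp
qed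

text \<open>For positive \<open>a\<close> the terms of the exponential series at
  \<open>C / a\<close> would all be at least 1, yet they tend to 0.\<close>

lemma zero_if_power_le_fact:
  fixes a C :: real
  assumes "a \<ge> 0" and "\<And>n. fact n * a ^ n \<le> C ^ n"
  shows "a = 0"
proof (rule ccontr)
  assume "a \<noteq> 0"
  then have a: "a > 0" using assms(1) by simp
  have "(\<lambda>n. inverse (fact n) * (C / a) ^ n) \<longlonglongrightarrow> 0"
    by (rule summable_LIMSEQ_zero[OF summable_exp])
  moreover have "1 \<le> inverse (fact n) * (C / a) ^ n" for n
    using assms(2)[of n] a by (simp add: field_simps)
  ultimately have "(1::real) \<le> 0"
    by (meson LIMSEQ_le_const)
  then show False by simp
qed

lemma norm_funpow_le:
  fixes f :: "'a::real_normed_vector \<Rightarrow> 'a"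
  assumes "K \<ge> 0" and "\<And>x. norm (f x) \<le> norm x * K"
  shows "norm ((f ^^ n) x) \<le> K ^ n * norm x"
proof (induction n)
  case (Suc n)
  have "norm ((f ^^ Suc n) x) \<le> norm ((f ^^ n) x) * K"
    using assms(2) by simp
  also have "\<dots> \<le> (K ^ n * norm x) * K"
    using Suc assms(1) by (rule mult_right_mono)
  finally show ?case by (simp add: mult_ac)
qed simp

text \<open>An eigenvector \<open>v\<close> of \<open>T\<close> is also one of \<open>N\<close>,
  with eigenvalue \<open>l\<close>. Scalars drop out of commutators, so the power identity applies
  to \<open>shifted T w\<close>, which kills \<open>v\<close>. With norm bounds \<open>a\<close> for
  \<open>shifted T w\<close> and \<open>b\<close> for \<open>W\<close> it gives
  \<open>fact n * cmod l ^ n \<le> (a * b) ^ n\<close>, whence \<open>l = 0\<close>.\<close>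

lemma commuting_commutator_eq_zero:
  fixes T N W :: "'a::complex_hilbert \<Rightarrow> 'a"
  assumes T: "T \<in> B1 \<Omega>" and N: "bounded_clinear N" and W: "bounded_clinear W"
    and NT: "\<And>x. N (T x) = T (N x)" and comm: "\<And>x. N x = W (T x) - T (W x)"
  shows "N x = 0"
proof (rule eq_zero_if_zero_on_eigenvectors[where f = N, OF T])
  note Nl = bounded_clinearD[OF N] and Wl = bounded_clinearD[OF W]
  show "bounded_linear N" by (rule Nl)
  show "N (a *\<^sub>C x) = 0" if "N x = 0" for a x
    using that by (simp add: Nl)
  fix w v assume w: "w \<in> \<Omega>" and v: "v \<in> kernel (shifted T w)"
  let ?A = "shifted T w"
  note Al = bounded_clinearD[OF bounded_clinear_shifted[OF B1_D(1)[OF T], of w]]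
  show "N v = 0"
  proof (cases "v = 0")
    case True
    then show ?thesis by (simp add: Nl)
  next
    case False
    have "N v \<in> kernel ?A"
      using intertwiner_maps_eigenvectors[of N T T, OF N NT v] .
    then obtain l where l: "N v = l *\<^sub>C v"
      using B1_eigenvector_multiple[OF T w v False] by metis
    have Nn: "(N ^^ n) v = l ^ n *\<^sub>C v" for n
      by (induction n) (simp_all add: Nl l scaleC_one mult.commute)
    obtain a where a: "a \<ge> 0" "\<And>x. norm (?A x) \<le> norm x * a"
      using bounded_linear.nonneg_bounded[OF Al(1)] by metis
    obtain b where b: "b \<ge> 0" "\<And>x. norm (W x) \<le> norm x * b"
      using bounded_linear.nonneg_bounded[OF Wl(1)] by metis
    have "fact n * cmod l ^ n \<le> (a * b) ^ n" for n
    proof -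
      have "(?A ^^ n) ((W ^^ n) v) = (- 1) ^ n *\<^sub>R fact n *\<^sub>R (N ^^ n) v"
      proof (rule commutator_power_identity)
        show "?A v = 0" using v by (simp add: kernel_def)
        show "?A (W x) = W (?A x) - N x" for x
          by (simp add: shifted_def comm Wl)
        show "?A (N x) = N (?A x)" for x
          by (simp add: shifted_def NT Nl)
      qed (simp_all add: Al Wl Nl bounded_linear.linear)
      then have "fact n * (cmod l ^ n * norm v) = norm ((?A ^^ n) ((W ^^ n) v))"
        by (simp add: Nn norm_power power_abs abs_mult)
      also have "\<dots> \<le> a ^ n * norm ((W ^^ n) v)"
        by (rule norm_funpow_le[OF a])
      also have "\<dots> \<le> a ^ n * (b ^ n * norm v)"
        using a by (intro mult_left_mono norm_funpow_le[OF b]) simp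
      finally show ?thesis
        using False by (simp add: power_mult_distrib mult.assoc[symmetric])
    qed
    then have "cmod l = 0"
      by (intro zero_if_power_le_fact) auto
    then show ?thesis by (simp add: l)
  qed
qed

text \<open>Right cancellation: \<open>Y\<close> is continuous and vanishes on the dense range of
  \<open>X\<close>. This strips factors off a product of intertwiners.\<close>

lemma compose_nonzero_intertwiner_eq_zero:
  assumes "open \<Omega>" and "connected \<Omega>" and "T \<in> B1 \<Omega>" and "T' \<in> B1 \<Omega>"
    and "bounded_clinear X" and "\<And>x. X (T x) = T' (X x)" and "X x0 \<noteq> 0"
    and "bounded_clinear Y" and "\<And>x. Y (X x) = 0"
  shows "Y z = 0"
  using bounded_linear_eq_zero_on_dense[OF bounded_clinearD(1)[OF assms(8)]
      nonzero_intertwiner_dense_range[OF assms(1-7)]] assms(9) by auto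

section \<open>Unitary equivalence in the class FB2\<close>

lemma bounded_clinear_Pair_zero: "bounded_clinear (\<lambda>x::'a::complex_inner. (x, 0::'b::complex_inner))"
  by (simp add: bounded_clinear_def scaleC_prod_def bounded_linear_Pair bounded_linear_ident
      bounded_linear_zero)

lemma bounded_clinear_fst: "bounded_clinear (fst :: 'a::complex_inner \<times> 'b::complex_inner \<Rightarrow> 'a)"
  by (simp add: bounded_clinear_def scaleC_prod_def bounded_linear_fst)

lemma bounded_clinear_snd: "bounded_clinear (snd :: 'a::complex_inner \<times> 'b::complex_inner \<Rightarrow> 'b)"
  by (simp add: bounded_clinear_def scaleC_prod_def bounded_linear_snd)

lemma bounded_clinear_corner:
  assumes "bounded_clinear U"
  shows "bounded_clinear (\<lambda>x. fst (U (x, 0)))" and "bounded_clinear (\<lambda>x. snd (U (x, 0)))"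
  using bounded_clinear_compose[OF assms bounded_clinear_Pair_zero]
  by (rule bounded_clinear_compose[OF bounded_clinear_fst],
      rule bounded_clinear_compose[OF bounded_clinear_snd])

text \<open>Both are components of \<open>UT\<close> at \<open>(x, 0)\<close>. The second measures
  how far the upper left corner is from intertwining; it is the source of the commutator.\<close>

lemma intertwiner_corner:
  assumes U: "bounded_clinear U"
    and UT: "\<And>p. U (block_op T0 S (\<lambda>_. 0) T1 p) = block_op T0' S' (\<lambda>_. 0) T1' (U p)"
    and "S 0 = 0" and "T1 0 = 0"
  shows "snd (U (T0 x, 0)) = T1' (snd (U (x, 0)))"
    and "fst (U (T0 x, 0)) = T0' (fst (U (x, 0))) + S' (snd (U (x, 0)))"
  using UT[of "(x, 0)"] assms(3,4) by (simp_all add: block_op_def split: prod.splits)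

lemma corner_product_eq_zero:
  fixes T0 :: "'h0::complex_hilbert \<Rightarrow> 'h0" and T1 :: "'h1::complex_hilbert \<Rightarrow> 'h1"
    and T0' :: "'k0::complex_hilbert \<Rightarrow> 'k0" and T1' :: "'k1::complex_hilbert \<Rightarrow> 'k1"
  assumes \<Omega>: "open \<Omega>" "connected \<Omega>"
    and B: "T0 \<in> B1 \<Omega>" "T1 \<in> B1 \<Omega>" "T0' \<in> B1 \<Omega>" "T1' \<in> B1 \<Omega>"
    and S: "bounded_clinear S" "\<And>x. S (T1 x) = T0 (S x)" "S s \<noteq> 0"
    and S': "bounded_clinear S'" "\<And>x. S' (T1' x) = T0' (S' x)" "S' s' \<noteq> 0"
    and U: "bounded_clinear U" "\<And>p. U (block_op T0 S (\<lambda>_. 0) T1 p) = block_op T0' S' (\<lambda>_. 0) T1' (U p)"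
    and V: "bounded_clinear V" "\<And>p. V (block_op T0' S' (\<lambda>_. 0) T1' p) = block_op T0 S (\<lambda>_. 0) T1 (V p)"
  shows "(\<forall>x. snd (U (x, 0)) = 0) \<or> (\<forall>x. snd (V (x, 0)) = 0)"
proof (rule ccontr)
  assume nz: "\<not> ?thesis"
  define P where "P x = snd (U (x, 0))" for x
  define R where "R x = fst (U (x, 0))" for x
  define Q where "Q x = snd (V (x, 0))" for x
  have P: "bounded_clinear P" and Q: "bounded_clinear Q" and R: "bounded_clinear R"
    unfolding P_def[abs_def] Q_def[abs_def] R_def[abs_def]
    using bounded_clinear_corner[OF U(1)] bounded_clinear_corner[OF V(1)] by simp_all
  note QS' = bounded_clinear_compose[OF Q S'(1)]
  note QS'P = bounded_clinear_compose[OF QS' P]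
  have PT: "P (T0 x) = T1' (P x)" and RT: "R (T0 x) = T0' (R x) + S' (P x)" for x
    unfolding P_def R_def
    by (rule intertwiner_corner[OF U bounded_clinearD(5)[OF S(1)] bounded_clinearD(5)[OF B1_D(1)[OF B(2)]]])+
  have QT: "Q (T0' x) = T1 (Q x)" for x
    unfolding Q_def
    by (rule intertwiner_corner[OF V bounded_clinearD(5)[OF S'(1)] bounded_clinearD(5)[OF B1_D(1)[OF B(4)]]])
  obtain p q where pq: "P p \<noteq> 0" "Q q \<noteq> 0" using nz by (auto simp: P_def Q_def)
  have "Q (S' (P (S x))) = 0" for x
  proof (rule commuting_commutator_eq_zero[where N = "\<lambda>x. Q (S' (P (S x)))"
        and W = "\<lambda>x. Q (R (S x))", OF B(2)])
    show "bounded_clinear (\<lambda>x. Q (S' (P (S x))))"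
      by (rule bounded_clinear_compose[OF QS'P S(1)])
    show "bounded_clinear (\<lambda>x. Q (R (S x)))"
      by (rule bounded_clinear_compose[OF Q bounded_clinear_compose[OF R S(1)]])
    show "Q (S' (P (S (T1 x)))) = T1 (Q (S' (P (S x))))" for x
      by (simp add: S S' PT QT)
    \<comment> \<open>Substitute \<open>S' P = R T0 - T0' R\<close>; then \<open>T0\<close> passes
      through \<open>S\<close> and \<open>T0'\<close> through \<open>Q\<close>, both becoming
      \<open>T1\<close>.\<close>
    show "Q (S' (P (S x))) = Q (R (S (T1 x))) - T1 (Q (R (S x)))" for x
      by (simp add: S RT QT bounded_clinearD(3)[OF Q])
  qed
  \<comment> \<open>The nonzero intertwiners \<open>S\<close>, \<open>P\<close> and
    \<open>S'\<close> are cancelled from the right in turn, until \<open>Q\<close> itself is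
    zero.\<close>
  then have "Q (S' (P z)) = 0" for z
    using compose_nonzero_intertwiner_eq_zero[OF \<Omega> B(2,1) S QS'P] by blast
  then have "Q (S' z) = 0" for z
    using compose_nonzero_intertwiner_eq_zero[OF \<Omega> B(1,4) P PT pq(1) QS'] by blast
  then have "Q z = 0" for z
    using compose_nonzero_intertwiner_eq_zero[OF \<Omega> B(4,3) S' Q] by blast
  then show False using pq by blast
qed

text \<open>An isometric image of a complete space is complete, hence closed.\<close>

lemma surj_if_isometric_dense_range:
  fixes X :: "'a::banach \<Rightarrow> 'b::real_normed_vector"
  assumes "bounded_linear X" and "\<And>x. norm (X x) = norm x" and "closure (range X) = UNIV"
  shows "surj X"
proof -
  have "complete (range X)"
    using complete_isometric_image[of 1 UNIV X] assms by (simp add: complete_UNIV)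
  then have "closed (range X)" by (rule complete_imp_closed)
  then show ?thesis using assms(3) by (simp add: closure_closed)
qed

text \<open>The corner of \<open>V\<close> in \<open>'k0 \<rightarrow> 'h0\<close> is then an isometric intertwiner, hence onto, so \<open>V\<close> maps the first
  summand onto the first summand.\<close>

lemma corner_eq_zero_if_inverse_corner_eq_zero:
  fixes T0 :: "'h0::complex_hilbert \<Rightarrow> 'h0" and T1 :: "'h1::complex_hilbert \<Rightarrow> 'h1"
    and T0' :: "'k0::complex_hilbert \<Rightarrow> 'k0" and T1' :: "'k1::complex_hilbert \<Rightarrow> 'k1"
  assumes \<Omega>: "open \<Omega>" "connected \<Omega>" and B: "T0 \<in> B1 \<Omega>" "T0' \<in> B1 \<Omega>"
    and S: "S 0 = 0" and S': "S' 0 = 0" "S' s' \<noteq> 0" and T1': "T1' 0 = 0"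
    and V: "bounded_clinear V" "\<And>p. V (block_op T0' S' (\<lambda>_. 0) T1' p) = block_op T0 S (\<lambda>_. 0) T1 (V p)"
    and "\<And>p. norm (V p) = norm p" and "\<And>p. U (V p) = p"
    and Q: "\<And>x. snd (V (x, 0)) = 0"
  shows "snd (U (x, 0)) = 0"
proof -
  define X where "X x = fst (V (x, 0))" for x
  have VX: "V (x, 0) = (X x, 0)" for x
    using Q[of x] by (simp add: X_def prod_eq_iff)
  have X: "bounded_clinear X"
    unfolding X_def[abs_def] using V(1) by (rule bounded_clinear_corner)
  have iso: "norm (X x) = norm x" for x
    using assms(11)[of "(x, 0)"] by (simp add: VX norm_Pair)
  have XT: "X (T0' x) = T0 (X x)" for x
    using intertwiner_corner(2)[OF V S'(1) T1', of x] by (simp add: VX S)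
  \<comment> \<open>\<open>S' s'\<close> is a nonzero vector, on which the isometry \<open>X\<close>
    cannot vanish; this makes the range of \<open>X\<close> dense.\<close>
  have "X (S' s') \<noteq> 0"
    using iso[of "S' s'"] S' by auto
  then have "surj X"
    using nonzero_intertwiner_dense_range[OF \<Omega> B(2,1) X XT] bounded_clinearD(1)[OF X] iso
    by (intro surj_if_isometric_dense_range)
  then obtain z where "X z = x" by (metis surjD)
  then have "U (x, 0) = (z, 0)"
    using assms(12)[of "(z, 0)"] VX[of z] by simp
  then show ?thesis by simp
qed

text \<open>Membership in \<open>FB2\<close> provides some blocks, a priori different from the given
  ones. Evaluation at \<open>(x, 0)\<close> and \<open>(0, y)\<close> identifies them, as all blocks
  send 0 to 0.\<close>

lemma FB2_block_opD:
  fixes T0 :: "'a::complex_hilbert \<Rightarrow> 'a" and T1 :: "'b::complex_hilbert \<Rightarrow> 'b"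
  assumes "block_op T0 S (\<lambda>_. 0) T1 \<in> FB2 \<Omega>"
    and "bounded_clinear T0" and "bounded_clinear S" and "bounded_clinear T1"
  shows "T0 \<in> B1 \<Omega>" "T1 \<in> B1 \<Omega>" "\<And>x. S (T1 x) = T0 (S x)" "\<exists>x. S x \<noteq> 0"
proof -
  obtain A R C where eq: "block_op T0 S (\<lambda>_. 0) T1 = block_op A R (\<lambda>_. 0) C"
    and A: "A \<in> B1 \<Omega>" and C: "C \<in> B1 \<Omega>" and R: "bounded_clinear R" "R \<noteq> (\<lambda>_. 0)" "A \<circ> R = R \<circ> C"
    using assms(1) by (auto simp: FB2_def)
  note z = bounded_clinearD(5)
  have "T0 x = A x" "S y = R y" "T1 y = C y" for x y
    using fun_cong[OF eq, of "(x, 0)"] fun_cong[OF eq, of "(0, y)"]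
      z[OF assms(2)] z[OF assms(3)] z[OF assms(4)] z[OF R(1)] z[OF B1_D(1)[OF A]] z[OF B1_D(1)[OF C]]
    by (simp_all add: block_op_def)
  then have [simp]: "T0 = A" "S = R" "T1 = C" by auto
  show "T0 \<in> B1 \<Omega>" "T1 \<in> B1 \<Omega>" by (simp_all add: A C)
  show "\<And>x. S (T1 x) = T0 (S x)" "\<exists>x. S x \<noteq> 0"
    using R by (auto simp: fun_eq_iff)
qed

lemma unitary_inverse:
  assumes "unitary U"
  obtains V where "unitary V" "\<And>p. U (V p) = p" "\<And>p. V (U p) = p"
proof -
  have U: "bounded_clinear U" "surj U" "\<And>x y. cinner (U x) (U y) = cinner x y"
    using assms by (auto simp: unitary_def)
  note Ul = bounded_clinearD[OF U(1)]
  have "inj U"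
  proof (rule injI)
    fix x y assume "U x = U y"
    then have "cinner (x - y) (x - y) = 0"
      using U(3)[of "x - y" "x - y"] by (simp add: Ul)
    then show "x = y" by (simp add: cinner_eq_zero_iff)
  qed
  define V where "V = inv U"
  have UV: "U (V p) = p" for p
    by (simp add: V_def surj_f_inv_f[OF U(2)])
  have VU: "V (U p) = p" for p
    by (simp add: V_def \<open>inj U\<close>)
  have V: "cinner (V x) (V y) = cinner x y" for x y
    using U(3)[of "V x" "V y"] by (simp add: UV)
  have Vadd: "V (x + y) = V x + V y" and VC: "V (a *\<^sub>C x) = a *\<^sub>C V x" for x y a
    using VU[of "V x + V y"] VU[of "a *\<^sub>C V x"] by (simp_all add: Ul UV)
  have "bounded_clinear V"
    unfolding bounded_clinear_def
  proof safe
    show "bounded_linear V"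
      by (rule bounded_linear_intro[of _ 1])
        (simp_all add: Vadd VC scaleR_scaleC norm_eq_sqrt_inner inner_cinner V)
  qed (rule VC)
  then have "unitary V"
    unfolding unitary_def using V VU by (metis surjI)
  with UV VU show thesis by (intro that)
qed

lemma unitary_norm:
  assumes "unitary U"
  shows "norm (U x) = norm x"
  using assms by (simp add: unitary_def norm_eq_sqrt_inner inner_cinner)

theorem proposition2p6:
  fixes \<Omega> :: "complex set"
    and T :: "'h0::complex_hilbert \<times> 'h1::complex_hilbert \<Rightarrow> 'h0 \<times> 'h1"
    and T' :: "'k0::complex_hilbert \<times> 'k1::complex_hilbert \<Rightarrow> 'k0 \<times> 'k1"
    and T0 :: "'h0 \<Rightarrow> 'h0" and S :: "'h1 \<Rightarrow> 'h0" and T1 :: "'h1 \<Rightarrow> 'h1"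
    and T0' :: "'k0 \<Rightarrow> 'k0" and S' :: "'k1 \<Rightarrow> 'k0" and T1' :: "'k1 \<Rightarrow> 'k1"
    and U :: "'h0 \<times> 'h1 \<Rightarrow> 'k0 \<times> 'k1"
    and U11 :: "'h0 \<Rightarrow> 'k0" and U12 :: "'h1 \<Rightarrow> 'k0"
    and U21 :: "'h0 \<Rightarrow> 'k1" and U22 :: "'h1 \<Rightarrow> 'k1"
  assumes "open \<Omega>" and "connected \<Omega>"
    and "T \<in> FB2 \<Omega>" and "T' \<in> FB2 \<Omega>"
    and "bounded_clinear T0" and "bounded_clinear S" and "bounded_clinear T1"
    and "T = block_op T0 S (\<lambda>_. 0) T1"
    and "bounded_clinear T0'" and "bounded_clinear S'" and "bounded_clinear T1'"
    and "T' = block_op T0' S' (\<lambda>_. 0) T1'"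
    and "bounded_clinear U11" and "bounded_clinear U12"
    and "bounded_clinear U21" and "bounded_clinear U22"
    and "U = block_op U11 U12 U21 U22"
    and "unitary U"
    and "U \<circ> T = T' \<circ> U"
  shows "U12 = (\<lambda>_. 0) \<and> U21 = (\<lambda>_. 0)"
proof -
  note \<Omega> = assms(1,2) and S = assms(6) and S' = assms(10)
  note z = bounded_clinearD(5)
  note T = FB2_block_opD[OF assms(3)[unfolded assms(8)] assms(5-7)]
  note T' = FB2_block_opD[OF assms(4)[unfolded assms(12)] assms(9-11)]
  obtain s s' where s: "S s \<noteq> 0" and s': "S' s' \<noteq> 0"
    using T(4) T'(4) by blast
  obtain V where V: "unitary V" and UV: "\<And>p. U (V p) = p" and VU: "\<And>p. V (U p) = p"
    using unitary_inverse[OF \<open>unitary U\<close>] by metis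
  have Ub: "bounded_clinear U" and Vb: "bounded_clinear V"
    using \<open>unitary U\<close> V by (auto simp: unitary_def)
  have UT: "U (block_op T0 S (\<lambda>_. 0) T1 p) = block_op T0' S' (\<lambda>_. 0) T1' (U p)" for p
    using fun_cong[OF assms(19), of p] by (simp add: assms(8,12))
  have VT: "V (block_op T0' S' (\<lambda>_. 0) T1' p) = block_op T0 S (\<lambda>_. 0) T1 (V p)" for p
    using UT[of "V p"] VU[of "block_op T0 S (\<lambda>_. 0) T1 (V p)"] by (simp add: UV)
  have "(\<forall>x. snd (U (x, 0)) = 0) \<or> (\<forall>x. snd (V (x, 0)) = 0)"
    by (rule corner_product_eq_zero[OF \<Omega> T(1,2) T'(1,2) S T(3) s S' T'(3) s' Ub UT Vb VT])
  \<comment> \<open>The same lemma is applied twice with \<open>U\<close> and \<open>V\<close>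
    exchanged, so either alternative makes both lower left corners vanish.\<close>
  moreover have "snd (U (x, 0)) = 0" if "\<forall>x. snd (V (x, 0)) = 0" for x
    using corner_eq_zero_if_inverse_corner_eq_zero[OF \<Omega> T(1) T'(1) z[OF S] z[OF S'] s'
        z[OF assms(11)] Vb VT unitary_norm[OF V] UV] that by blast
  moreover have "snd (V (x, 0)) = 0" if "\<forall>x. snd (U (x, 0)) = 0" for x
    using corner_eq_zero_if_inverse_corner_eq_zero[OF \<Omega> T'(1) T(1) z[OF S'] z[OF S] s
        z[OF assms(7)] Ub UT unitary_norm[OF \<open>unitary U\<close>] VU] that by blast
  ultimately have P: "snd (U (x, 0)) = 0" and Q: "snd (V (y, 0)) = 0" for x y
    by blast+
  have "U21 x = 0" for x
    using P[of x] z[OF assms(16)] by (simp add: assms(17) block_op_def)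
  moreover have "U12 y = 0" for y
  proof -
    \<comment> \<open>The lower left corner of \<open>V\<close> is the adjoint of
      \<open>U12\<close>, so its vanishing annihilates the squared norm of
      \<open>U12 y\<close>.\<close>
    have "cinner (U12 y) (U12 y) = cinner (U (0, y)) (U12 y, 0)"
      using z[OF assms(13)] z[OF assms(15)]
      by (simp add: assms(17) block_op_def cinner_prod_def)
    also have "\<dots> = cinner (U (0, y)) (U (V (U12 y, 0)))"
      by (simp add: UV)
    also have "\<dots> = cinner (0, y) (V (U12 y, 0))"
      using \<open>unitary U\<close> unfolding unitary_def by blast
    also have "\<dots> = 0"
      by (simp add: cinner_prod_def Q)
    finally show ?thesis by (simp add: cinner_eq_zero_iff)
  qed
  ultimately show ?thesis by auto
qed

end
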